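(* Let $k\ge1$, $\mathbf{n}\in\mathbb{Z}_{\ge0}^k$, $\lambda_j>-1$ $(j=1,\ldots,k)$ and $\alpha>-1$, and put $\bm{\lambda}=(\lambda_1,\ldots,\lambda_k)$. Then, for $\mathbf{x}\in\mathbb{C}^k$, $$L_{\mathbf{n}}^{(\langle\bm{\lambda}\rangle+\alpha+k)}(\mathbf{x})=\frac{\Gamma(\langle\bm{\lambda}+\mathbf{n}\rangle+\alpha+k+1)}{\Gamma(\lambda_1+1+n_1)\cdots\Gamma(\lambda_k+1+n_k)}\;K_{\mathbf{x}}^{\alpha+1,\bm{\lambda}+\mathbf{1}}\prod_{j=1}^{k}L_{n_j}^{(\lambda_j)}(x_j).$$
   Context: Boldface letters denote vectors of dimension $k$: $\langle\mathbf{x}\rangle:=x_1+\cdots+x_k$, $\mathbf{x}\circ\mathbf{y}:=(x_1y_1,\ldots,x_ky_k)$, $\mathbf{x}^{\mathbf{n}}:=x_1^{n_1}\cdots x_k^{n_k}$, $\mathbf{1}=(1,\ldots,1)$. Erdélyi's multivariate Laguerre polynomials $L_{\mathbf{n}}^{(\alpha)}(\mathbf{x})=L_{n_1,\ldots,n_k}^{(\alpha)}(x_1,\ldots,x_k)$ are defined by $$(1-\langle\mathbf{z}\rangle)^{-\alpha-1}\exp\left\{-\frac{\langle\mathbf{x}\circ\mathbf{z}\rangle}{1-\langle\mathbf{z}\rangle}\right\}=\sum_{\mathbf{n}\in\mathbb{Z}_{\ge0}^k}L_{\mathbf{n}}^{(\alpha)}(\mathbf{x})\,\mathbf{z}^{\mathbf{n}},\qquad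 |z_1|+\cdots+|z_k|<1;$$ for $k=1$ these are the usual Laguerre polynomials $L_n^{(\alpha)}(x)$. Let $E_k=\{\mathbf{s}\in\mathbb{R}^k: s_j\ge0,\ \langle\mathbf{s}\rangle\le1\}$ be the standard simplex. Oshima's operator, $K_{\mathbf{x}}^{\alpha,\bm{\lambda}}:=\mathbf{x}^{\mathbf{1}-\bm{\lambda}}K_{\mathbf{x}}^{\alpha}\mathbf{x}^{\bm{\lambda}-\mathbf{1}}$ with $K_{\mathbf{x}}^{\alpha}f(\mathbf{x}):=\frac{1}{\Gamma(\alpha)}\int_{E_k}(1-\langle\mathbf{s}\rangle)^{\alpha-1}f(\mathbf{x}\circ\mathbf{s})\,\mathrm{d}\mathbf{s}$, is given explicitly (for $\alpha>0$, $\lambda_j>0$) by $$K_{\mathbf{x}}^{\alpha,\bm{\lambda}}f(\mathbf{x})=\frac{1}{\Gamma(\alpha)}\int_{E_k}s_1^{\lambda_1-1}\cdots s_k^{\lambda_k-1}(1-\langle\mathbf{s}\rangle)^{\alpha-1}f(\mathbf{x}\circ\mathbf{s})\,\mathrm{d}\mathbf{s}.$$ *)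

theory Defs
  imports "HOL-Analysis.Analysis"
begin

definition coord_sum :: "('a::comm_monoid_add) ^ 'k \<Rightarrow> 'a" where
  "coord_sum x = (\<Sum>j\<in>UNIV. x $ j)"

definition hadamard :: "('a::times) ^ 'k \<Rightarrow> 'a ^ 'k \<Rightarrow> 'a ^ 'k" where
  "hadamard x y = (\<chi> j. x $ j * y $ j)"

definition monomial :: "('a::comm_monoid_mult) ^ 'k \<Rightarrow> nat ^ 'k \<Rightarrow> 'a" where
  "monomial x n = (\<Prod>j\<in>UNIV. x $ j ^ (n $ j))"

(* The power powr is the principal branch; on the domain \<Sum>|z_j| < 1 of the
   expansion below the base 1 - <z> has positive real part. *)
definition laguerre_gen :: "real \<Rightarrow> complex ^ 'k \<Rightarrow> complex ^ 'k \<Rightarrow> complex" where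
  "laguerre_gen \<alpha> x z =
     (1 - coord_sum z) powr complex_of_real (- \<alpha> - 1) *
     exp (- (coord_sum (hadamard x z) / (1 - coord_sum z)))"

(* The coefficient family of the generating function, as a family indexed by all of Z_{>=0}^k.
   The series is summed unconditionally (has_sum), as there is no preferred order
   on multi-indices; the expansion determines the coefficients uniquely. *)
definition laguerre :: "real \<Rightarrow> nat ^ 'k \<Rightarrow> complex ^ 'k \<Rightarrow> complex" where
  "laguerre \<alpha> n x =
     (THE c :: nat ^ 'k \<Rightarrow> complex.
        \<forall>z. (\<Sum>j\<in>UNIV. norm (z $ j)) < 1 \<longrightarrow>
            ((\<lambda>m. c m * monomial z m) has_sum laguerre_gen \<alpha> x z) UNIV) n"

(* The usual one-variable Laguerre polynomials: the case k = 1. *)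
definition laguerre1 :: "real \<Rightarrow> nat \<Rightarrow> complex \<Rightarrow> complex" where
  "laguerre1 \<alpha> n x = laguerre \<alpha> (vec n :: nat ^ 1) (vec x)"

definition std_simplex :: "(real ^ 'k) set" where
  "std_simplex = {s. (\<forall>j. 0 \<le> s $ j) \<and> coord_sum s \<le> 1}"

(* Explicit integral form of Oshima's operator, meaningful for \<alpha> > 0 and lam_j > 0;
   ds is Lebesgue measure on R^k. *)
definition oshima_K ::
  "real \<Rightarrow> real ^ 'k \<Rightarrow> (complex ^ 'k \<Rightarrow> complex) \<Rightarrow> complex ^ 'k \<Rightarrow> complex" where
  "oshima_K \<alpha> lam f x =
     complex_of_real (1 / Gamma \<alpha>) *
     (LINT s:std_simplex|lborel.
        complex_of_real ((\<Prod>j\<in>UNIV. s $ j powr (lam $ j - 1)) * (1 - coord_sum s) powr (\<alpha> - 1)) *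
        f (hadamard x (\<chi> j. complex_of_real (s $ j))))"

end

theory Submission
  imports Defs
begin

text \<open>
  Both sides are polynomials in \<open>x\<close>, and they agree coefficient by coefficient. Write
  \<open>\<langle>z\<rangle> = z\<^sub>1 + \<dots> + z\<^sub>k\<close> for vectors and, for multi-indices,
  \<open>|m| = m\<^sub>1 + \<dots> + m\<^sub>k\<close> and \<open>m! = m\<^sub>1! \<cdots> m\<^sub>k!\<close>. Expanding the exponential in the generating
  function and then each resulting power of \<open>1 - \<langle>z\<rangle>\<close> gives
  \[ L_n^{(\alpha)}(x) = \sum_{m \le n} \frac{(-x)^m}{m!\,(n-m)!} (\alpha + 1 + |m|)_{|n|-|m|}, \]
  where the Pochhammer symbol is the quotient
  \<open>\<Gamma>(\<alpha> + 1 + |n|) / \<Gamma>(\<alpha> + 1 + |m|)\<close>. Insert the case \<open>k = 1\<close> of this formula into the product of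
  one-variable Laguerre polynomials on the right. The operator then acts on each monomial \<open>x\<^sup>m\<close> by
  a Dirichlet integral
  \[ \int_{E_k} \prod_j s_j^{\lambda_j + m_j} (1 - \langle s \rangle)^\alpha \, ds
     = \frac{\Gamma(\alpha + 1) \prod_j \Gamma(\lambda_j + 1 + m_j)}{\Gamma(A + 1 + |m|)},
     \qquad A = \langle \lambda \rangle + \alpha + k. \]
  The factors \<open>\<Gamma>(\<lambda>\<^sub>j + 1 + m\<^sub>j)\<close> cancel the denominators of the one-variable Pochhammer symbols,
  and \<open>\<Gamma>(A + 1 + |m|)\<close> together with the prefactor \<open>\<Gamma>(A + 1 + |n|)\<close> forms the Pochhammer symbol
  of the left-hand side.

  Three facts carry the argument. Coefficients of a multivariate power series are determined by its
  values on the domain \<open>\<Sum>|z\<^sub>j| < 1\<close> (\<open>power_series_coeffs_unique\<close>), which is what lets a definite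
  description of the coefficient family be evaluated. The double series over the exponential and
  binomial expansions converges unconditionally (\<open>laguerre_double_series\<close>), so it may be collected
  by powers of \<open>z\<close>; this uses \<open>\<alpha> > -1\<close>, when all Pochhammer symbols involved are positive and
  norms of terms are themselves terms of such a series. The Dirichlet integral
  (\<open>dirichlet_nn_integral\<close>) follows from scaling, Tonelli's theorem and the one-dimensional Gamma
  integral, without recursion over the number of variables.
\<close>

section \<open>Uniqueness of multivariate power series coefficients\<close>

lemma power_series_eq_zero_coeffs:
  fixes g :: "nat \<Rightarrow> complex"
  assumes "\<epsilon> > 0" and sums: "\<And>t. norm t < \<epsilon> \<Longrightarrow> ((\<lambda>p. g p * t ^ p) has_sum 0) UNIV"
  shows "g p = 0"
proof -
  have sums': "(\<lambda>p. g p * t ^ p) sums 0" if "norm t < \<epsilon>" for t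
    using sums[OF that] by (rule has_sum_imp_sums)
  have "conv_radius g \<ge> ereal \<epsilon>"
  proof (rule conv_radius_geI_ex')
    fix r :: real assume r: "0 < r" "ereal r < ereal \<epsilon>"
    then show "summable (\<lambda>n. g n * of_real r ^ n)"
      using sums'[of "of_real r"] by (auto simp: sums_iff)
  qed
  then have R: "fps_conv_radius (Abs_fps g) > 0"
    using \<open>\<epsilon> > 0\<close> by (simp add: fps_conv_radius_def less_le_trans[of _ "ereal \<epsilon>"])
  have "eventually (\<lambda>z::complex. z \<in> ball 0 \<epsilon>) (nhds 0)"
    using \<open>\<epsilon> > 0\<close> by (intro eventually_nhds_in_open) auto
  then have "eventually (\<lambda>z. eval_fps (Abs_fps g) z = eval_fps 0 z) (nhds 0)"
    by eventually_elim (use sums' in \<open>auto simp: eval_fps_def sums_iff\<close>)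
  then have "Abs_fps g = 0"
    using R by (intro eval_fps_eqD) auto
  then show ?thesis
    by (metis fps_nth_Abs_fps fps_zero_nth)
qed

lemma has_sum_minus:
  fixes f g :: "'a \<Rightarrow> complex"
  assumes "(f has_sum S) A" "(g has_sum T) A"
  shows "((\<lambda>x. f x - g x) has_sum (S - T)) A"
  using has_sum_add[OF assms(1), of "\<lambda>x. - g x" "- T"] assms(2) by (simp add: has_sum_uminus)

text \<open>
  Together with \<open>has_sum_SigmaD\<close> this sums a family by first summing over the fibres of \<open>h\<close>.
\<close>

lemma has_sum_fibres:
  assumes "(f has_sum S) A"
  shows "((\<lambda>(p, m). f m) has_sum S) (Sigma UNIV (\<lambda>p. {m \<in> A. h m = p}))"
proof -
  have "(f has_sum S) A \<longleftrightarrow>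
      ((\<lambda>(p, m). f m) has_sum S) (Sigma UNIV (\<lambda>p. {m \<in> A. h m = p}))"
    by (rule has_sum_reindex_bij_witness[of _ snd "\<lambda>m. (h m, m)"]) auto
  with assms show ?thesis by simp
qed

text \<open>
  The coordinates are fixed one at a time. For a coordinate \<open>i\<close> outside \<open>S\<close>, the series is a power
  series in \<open>z\<^sub>i\<close> alone once its terms are grouped by the exponent of \<open>z\<^sub>i\<close>, and the one-variable
  identity theorem kills the group with exponent \<open>n\<^sub>i\<close>. For \<open>S = UNIV\<close> a single coefficient remains.
\<close>

lemma coeffs_zero_slice:
  fixes c :: "nat ^ 'k \<Rightarrow> complex"
  assumes sums: "\<And>z. (\<Sum>j\<in>UNIV. norm (z $ j)) < 1 \<Longrightarrow> ((\<lambda>m. c m * monomial z m) has_sum 0) UNIV"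
    and "finite S"
  shows "(\<Sum>j\<in>UNIV. norm (z $ j)) < 1 \<Longrightarrow>
    ((\<lambda>m. c m * (\<Prod>j\<in>-S. z $ j ^ (m $ j))) has_sum 0) {m. \<forall>j\<in>S. m $ j = n $ j}"
  using \<open>finite S\<close>
proof (induction S arbitrary: z rule: finite_induct)
  case empty
  then show ?case using sums[of z] by (simp add: monomial_def)
next
  case (insert i S)
  define A where "A = {m. \<forall>j\<in>S. m $ j = n $ j}"
  define B where "B = (\<lambda>p. {m\<in>A. m $ i = p})"
  define f where "f = (\<lambda>m. c m * (\<Prod>j\<in>-insert i S. z $ j ^ (m $ j)))"
  define \<epsilon> where "\<epsilon> = 1 - (\<Sum>j\<in>-{i}. norm (z $ j))"
  have split: "(\<Sum>j\<in>UNIV. norm (y $ j)) = norm (y $ i) + (\<Sum>j\<in>-{i}. norm (y $ j))" for y :: "complex^'k"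
    by (subst sum.remove[of _ i]) (auto simp: Compl_eq_Diff_UNIV)
  have \<epsilon>: "\<epsilon> > 0"
    using insert.prems split[of z] norm_ge_zero[of "z $ i"] unfolding \<epsilon>_def by linarith
  have sum_f: "((\<lambda>m. f m * t ^ (m $ i)) has_sum 0) A" if t: "norm t < \<epsilon>" for t
  proof -
    define y where "y = (\<chi> j. if j = i then t else z $ j)"
    have "(\<Sum>j\<in>UNIV. norm (y $ j)) < 1"
      using t by (subst split) (simp add: y_def \<epsilon>_def)
    from insert.IH[OF this]
    have "((\<lambda>m. c m * (\<Prod>j\<in>-S. y $ j ^ (m $ j))) has_sum 0) A" by (simp add: A_def)
    moreover have "(\<Prod>j\<in>-S. y $ j ^ (m $ j)) = t ^ (m $ i) * (\<Prod>j\<in>-insert i S. z $ j ^ (m $ j))" for m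
    proof -
      have "-S - {i} = - insert i S" by auto
      then show ?thesis
        using insert.hyps by (subst prod.remove[of _ i]) (auto simp: y_def intro!: prod.cong)
    qed
    ultimately show ?thesis by (simp add: f_def mult_ac)
  qed
  have f_sum: "(f has_sum (infsum f (B p))) (B p)" for p
  proof -
    \<comment> \<open>Summability on a fibre follows from summability at any one nonzero value of the variable.\<close>
    define t :: complex where "t = of_real (\<epsilon> / 2)"
    have t: "norm t < \<epsilon>" "t \<noteq> 0" using \<epsilon> by (auto simp: t_def)
    have "(\<lambda>m. f m * t ^ (m $ i)) summable_on B p"
      using sum_f[OF t(1)] by (rule summable_on_subset_banach[OF has_sum_imp_summable]) (auto simp: B_def)
    also have "?this \<longleftrightarrow> (\<lambda>m. f m * t ^ p) summable_on B p"
      by (intro summable_on_cong) (auto simp: B_def)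
    finally have "(\<lambda>m. f m * t ^ p * inverse (t ^ p)) summable_on B p"
      by (rule summable_on_cmult_left)
    then have "f summable_on B p" using t(2) by (simp add: mult.assoc)
    then show ?thesis by simp
  qed
  have "infsum f (B p) = 0" for p
  proof (rule power_series_eq_zero_coeffs[OF \<epsilon>])
    fix t :: complex assume t: "norm t < \<epsilon>"
    from has_sum_fibres[OF sum_f[OF t], of "\<lambda>m. m $ i"]
    have "((\<lambda>(p, m). f m * t ^ (m $ i)) has_sum 0) (Sigma UNIV B)" by (simp add: B_def)
    moreover have "((\<lambda>m. (case (p, m) of (p, m) \<Rightarrow> f m * t ^ (m $ i))) has_sum (infsum f (B p) * t ^ p)) (B p)" for p
    proof -
      have "((\<lambda>m. f m * t ^ p) has_sum (infsum f (B p) * t ^ p)) (B p)"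
        by (rule has_sum_cmult_left[OF f_sum])
      then show ?thesis by (rule has_sum_cong[THEN iffD1, rotated]) (auto simp: B_def)
    qed
    ultimately show "((\<lambda>p. infsum f (B p) * t ^ p) has_sum 0) UNIV"
      by (rule has_sum_SigmaD)
  qed
  moreover have "B (n $ i) = {m. \<forall>j\<in>insert i S. m $ j = n $ j}"
    by (auto simp: B_def A_def)
  ultimately have "(f has_sum 0) {m. \<forall>j\<in>insert i S. m $ j = n $ j}"
    using f_sum[of "n $ i"] by metis
  then show ?case by (simp only: f_def)
qed

lemma power_series_coeffs_unique:
  fixes c d :: "nat ^ 'k \<Rightarrow> complex"
  assumes c: "\<And>z. (\<Sum>j\<in>UNIV. norm (z $ j)) < 1 \<Longrightarrow> ((\<lambda>m. c m * monomial z m) has_sum F z) UNIV"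
    and d: "\<And>z. (\<Sum>j\<in>UNIV. norm (z $ j)) < 1 \<Longrightarrow> ((\<lambda>m. d m * monomial z m) has_sum F z) UNIV"
  shows "c = d"
proof
  fix n :: "nat ^ 'k"
  have "((\<lambda>m. (c m - d m) * monomial z m) has_sum 0) UNIV" if "(\<Sum>j\<in>UNIV. norm (z $ j)) < 1" for z
    using has_sum_minus[OF c[OF that] d[OF that]] by (simp add: algebra_simps)
  from coeffs_zero_slice[OF this, of UNIV 0 n]
  have "((\<lambda>m. c m - d m) has_sum 0) {m. \<forall>j. m $ j = n $ j}" by simp
  moreover have "{m. \<forall>j. m $ j = n $ j} = {n}" by (auto simp: vec_eq_iff)
  ultimately have "((\<lambda>m. c m - d m) has_sum 0) {n}" by simp
  moreover have "((\<lambda>m. c m - d m) has_sum (c n - d n)) {n}"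
    by (rule has_sum_finiteI) auto
  ultimately show "c n = d n" using has_sum_unique by fastforce
qed

section \<open>Exponential series and multinomial theorem\<close>

text \<open>
  In multi-index notation this is \<open>w\<^sup>m / m!\<close>.
\<close>

definition divided_monomial :: "complex ^ 'k \<Rightarrow> nat ^ 'k \<Rightarrow> complex" where
  "divided_monomial w m = (\<Prod>j\<in>UNIV. w $ j ^ (m $ j) / fact (m $ j))"

lemma has_sum_prod_vec:
  fixes f :: "'k::finite \<Rightarrow> nat \<Rightarrow> complex"
  assumes abs: "\<And>j. (\<lambda>i. norm (f j i)) summable_on UNIV"
    and f: "\<And>j. (f j has_sum s j) UNIV"
  shows "((\<lambda>m::nat^'k. \<Prod>j\<in>UNIV. f j (m $ j)) has_sum (\<Prod>j\<in>UNIV. s j)) UNIV"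
proof -
  let ?P = "\<lambda>g. \<Prod>j\<in>UNIV. f j (g j)" and ?E = "PiE UNIV (\<lambda>_::'k. UNIV :: nat set)"
  have "(\<lambda>g. norm (?P g)) summable_on ?E"
    using abs_summable_on_prod_PiE[of UNIV "\<lambda>_. UNIV" f] abs
    by (auto simp: abs_summable_equivalent[symmetric])
  then have "?P summable_on ?E" by (rule abs_summable_summable)
  moreover have "infsum ?P ?E = (\<Prod>j\<in>UNIV. infsum (f j) UNIV)"
    by (rule infsum_prod_PiE_abs) (use abs in auto)
  moreover have "infsum (f j) UNIV = s j" for j using f by (rule infsumI)
  ultimately have "(?P has_sum (\<Prod>j\<in>UNIV. s j)) ?E"
    using has_sum_infsum[of ?P ?E] by (simp only:)
  moreover have "(?P has_sum (\<Prod>j\<in>UNIV. s j)) ?E \<longleftrightarrow>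
      ((\<lambda>m::nat^'k. \<Prod>j\<in>UNIV. f j (m $ j)) has_sum (\<Prod>j\<in>UNIV. s j)) UNIV"
    by (rule has_sum_reindex_bij_witness[of _ "\<lambda>m j. m $ j" "\<lambda>g. \<chi> j. g j"]) auto
  ultimately show ?thesis by simp
qed

lemma divided_monomial_has_sum_exp:
  fixes w :: "complex ^ 'k"
  shows "(divided_monomial w has_sum exp (coord_sum w)) UNIV"
proof -
  have e: "(\<lambda>i. w $ j ^ i / fact i) sums exp (w $ j)" for j
    using exp_converges[of "w $ j"] by (simp add: scaleR_conv_of_real divide_inverse mult.commute)
  have n: "summable (\<lambda>i. norm (w $ j ^ i / fact i))" for j
    using summable_norm_exp[of "w $ j"] by (simp add: norm_divide norm_power divide_inverse mult.commute norm_mult norm_inverse)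
  show ?thesis
    unfolding divided_monomial_def[abs_def] coord_sum_def exp_sum[OF finite_class.finite_UNIV]
    by (rule has_sum_prod_vec)
      (use e n in \<open>auto intro!: norm_summable_imp_has_sum norm_summable_imp_summable_on\<close>)
qed

lemma finite_multi_indices_below [simp]: "finite {m :: nat ^ 'k. \<forall>j. m $ j \<le> n $ j}"
proof (rule finite_subset)
  show "finite ((\<lambda>g. \<chi> j. g j) ` PiE (UNIV::'k set) (\<lambda>j. {..n $ j}))"
    by (intro finite_imageI finite_PiE) auto
  show "{m :: nat ^ 'k. \<forall>j. m $ j \<le> n $ j} \<subseteq> (\<lambda>g. \<chi> j. g j) ` PiE UNIV (\<lambda>j. {..n $ j})"
  proof
    fix m :: "nat ^ 'k" assume "m \<in> {m. \<forall>j. m $ j \<le> n $ j}"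
    then show "m \<in> (\<lambda>g. \<chi> j. g j) ` PiE UNIV (\<lambda>j. {..n $ j})"
      by (intro image_eqI[of _ _ "\<lambda>j. m $ j"]) (auto simp: vec_eq_iff)
  qed
qed

lemma finite_multi_indices_of_degree [simp]: "finite {l :: nat ^ 'k. coord_sum l = p}"
proof (rule finite_subset)
  show "{l :: nat ^ 'k. coord_sum l = p} \<subseteq> {l. \<forall>j. l $ j \<le> (\<chi> j. p) $ j}"
    unfolding coord_sum_def by (auto intro: member_le_sum)
qed (rule finite_multi_indices_below)

lemma divided_monomial_scale:
  "divided_monomial (t *s w) m = t ^ coord_sum m * divided_monomial w m"
  by (simp add: divided_monomial_def coord_sum_def power_mult_distrib prod.distrib power_sum
      flip: times_divide_eq_right)

text \<open>
  In the product of the exponential series of the coordinates of \<open>t w\<close>, the terms of total degree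
  \<open>p\<close> carry the factor \<open>t\<^sup>p\<close>. Comparing coefficients of \<open>t\<close> with the exponential series of
  \<open>t \<langle>w\<rangle>\<close> gives the claim.
\<close>

lemma multinomial_theorem:
  "(\<Sum>l | coord_sum l = p. divided_monomial w l) = coord_sum w ^ p / fact p"
proof -
  define G where "G = (\<lambda>p. \<Sum>l | coord_sum l = p. divided_monomial w l)"
  have "G p - coord_sum w ^ p / fact p = 0"
  proof (rule power_series_eq_zero_coeffs[of 1 "\<lambda>p. G p - coord_sum w ^ p / fact p"])
    fix t :: complex
    have "((\<lambda>(p, l). divided_monomial (t *s w) l) has_sum exp (coord_sum (t *s w)))
        (Sigma UNIV (\<lambda>p. {l \<in> UNIV. coord_sum l = p}))"
      by (intro has_sum_fibres divided_monomial_has_sum_exp)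
    then have 1: "((\<lambda>p. G p * t ^ p) has_sum exp (coord_sum (t *s w))) UNIV"
      by (rule has_sum_SigmaD)
        (auto intro!: has_sum_finiteI simp: divided_monomial_scale G_def sum_distrib_left mult_ac)
    have "coord_sum (t *s w) = t * coord_sum w"
      by (simp add: coord_sum_def sum_distrib_left)
    moreover have "((\<lambda>p. (t * coord_sum w) ^ p / fact p) has_sum exp (t * coord_sum w)) UNIV"
      using exp_converges[of "t * coord_sum w"] summable_norm_exp[of "t * coord_sum w"]
      by (intro norm_summable_imp_has_sum)
        (auto simp: scaleR_conv_of_real divide_inverse mult.commute norm_mult norm_power norm_inverse)
    ultimately show "((\<lambda>p. (G p - coord_sum w ^ p / fact p) * t ^ p) has_sum 0) UNIV"
      using has_sum_minus[OF 1] by (fastforce simp: algebra_simps power_mult_distrib)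
  qed simp
  then show ?thesis by (simp add: G_def)
qed

section \<open>Negative binomial series in several variables\<close>

text \<open>
  Replacing \<open>w\<close> by \<open>norm_vec w\<close> turns the terms of the series below into their norms. This reduces
  absolute convergence at \<open>w\<close> to convergence at \<open>norm_vec w\<close>.
\<close>

definition norm_vec :: "complex ^ 'k \<Rightarrow> complex ^ 'k" where
  "norm_vec w = (\<chi> j. of_real (norm (w $ j)))"

lemma divided_monomial_norm_vec:
  "divided_monomial (norm_vec w) m = of_real (norm (divided_monomial w m))"
  by (simp add: divided_monomial_def norm_vec_def norm_divide norm_power prod_norm[symmetric])

lemma coord_sum_norm_vec: "coord_sum (norm_vec w) = of_real (\<Sum>j\<in>UNIV. norm (w $ j))"
  by (simp add: coord_sum_def norm_vec_def)

text \<open>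
  Stated with both sides embedded in the complex numbers, so that norms of terms can be rewritten
  to terms of the same series at \<open>norm_vec\<close>.
\<close>

lemma norm_pochhammer_of_real:
  assumes "a > 0"
  shows "of_real (norm (pochhammer (of_real a) p :: complex)) = (pochhammer (of_real a) p :: complex)"
  using assms pochhammer_pos[of a p] by (simp add: pochhammer_of_real)

lemma binomial_series_neg:
  fixes w :: complex
  assumes "norm w < 1"
  shows "(\<lambda>p. pochhammer (of_real a) p * (w ^ p / fact p)) sums ((1 - w) powr of_real (- a))"
proof -
  have "(of_real (- a) gchoose p) * (- w) ^ p = pochhammer (of_real a) p * (w ^ p / fact p)" for p
  proof -
    have "(-1) ^ p * (- w) ^ p = w ^ p"
      by (simp flip: power_mult_distrib)
    then show ?thesis
      by (simp add: gbinomial_pochhammer field_simps)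
  qed
  then show ?thesis
    using gen_binomial_complex[of "- w" "of_real (- a)"] assms by simp
qed

lemma binomial_series_neg_has_sum:
  fixes w :: complex
  assumes "norm w < 1" "a > 0"
  shows "((\<lambda>p. pochhammer (of_real a) p * (w ^ p / fact p)) has_sum ((1 - w) powr of_real (- a))) UNIV"
proof (rule norm_summable_imp_has_sum)
  have "(\<lambda>p. pochhammer (of_real a) p * (of_real (norm w) ^ p / fact p)) sums
      ((1 - of_real (norm w) :: complex) powr of_real (- a))"
    using assms by (intro binomial_series_neg) auto
  then have "summable (\<lambda>p. Re (pochhammer (of_real a) p * (of_real (norm w) ^ p / fact p)))"
    by (intro summable_Re) (auto simp: sums_iff)
  also have "(\<lambda>p. Re (pochhammer (of_real a) p * (of_real (norm w) ^ p / fact p))) =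
      (\<lambda>p. norm (pochhammer (of_real a) p * (w ^ p / fact p) :: complex))"
  proof
    fix p
    have "pochhammer (of_real a) p * (of_real (norm w) ^ p / fact p) =
       complex_of_real (norm (pochhammer (of_real a) p * (w ^ p / fact p) :: complex))"
      using \<open>a > 0\<close> by (simp only: norm_mult norm_divide norm_power of_real_mult of_real_divide of_real_power
          norm_pochhammer_of_real[OF \<open>a > 0\<close>]) simp
    then show "Re (pochhammer (of_real a) p * (of_real (norm w) ^ p / fact p)) =
       norm (pochhammer (of_real a) p * (w ^ p / fact p) :: complex)"
      by (simp only: Re_complex_of_real)
  qed
  finally show "summable (\<lambda>p. norm (pochhammer (of_real a) p * (w ^ p / fact p) :: complex))" .
qed (use binomial_series_neg[OF assms(1)] in auto)

text \<open>
  The terms of total degree \<open>p\<close> add up, by the multinomial theorem, to the \<open>p\<close>-th term of the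
  one-variable series at \<open>\<langle>z\<rangle>\<close>. Grouping by degree is justified because \<open>\<Sum>|z\<^sub>j| < 1\<close>, not only
  \<open>|\<langle>z\<rangle>| < 1\<close>, makes the norms summable.
\<close>

lemma multivariate_binomial_series_neg:
  fixes z :: "complex ^ 'k"
  assumes z: "(\<Sum>j\<in>UNIV. norm (z $ j)) < 1" and a: "a > 0"
  shows "((\<lambda>l. pochhammer (of_real a) (coord_sum l) * divided_monomial z l) has_sum
    (1 - coord_sum z) powr of_real (- a)) UNIV"
proof -
  let ?f = "\<lambda>(p, l). pochhammer (of_real a) (coord_sum l) * divided_monomial z l"
  let ?D = "\<lambda>p. {l :: nat ^ 'k. l \<in> UNIV \<and> coord_sum l = p}"
  let ?r = "\<Sum>j\<in>UNIV. norm (z $ j)"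
  have fibre: "(\<Sum>l\<in>?D p. pochhammer (of_real a) (coord_sum l) * divided_monomial w l) =
      pochhammer (of_real a) p * (coord_sum w ^ p / fact p)" for p and w :: "complex ^ 'k"
    by (simp flip: multinomial_theorem sum_distrib_left)
  have "norm (coord_sum z) < 1"
    using z norm_sum[of "\<lambda>j. z $ j" UNIV] by (simp add: coord_sum_def)
  then have outer: "((\<lambda>p. pochhammer (of_real a) p * (coord_sum z ^ p / fact p)) has_sum
      (1 - coord_sum z) powr of_real (- a)) UNIV"
    using a by (intro binomial_series_neg_has_sum) auto
  have "(\<lambda>x. norm (?f x)) summable_on Sigma UNIV ?D"
  proof (rule summable_on_SigmaI)
    fix p
    show "((\<lambda>l. norm (?f (p, l))) has_sum (pochhammer a p * (?r ^ p / fact p))) (?D p)"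
    proof (rule has_sum_finiteI)
      have "complex_of_real (\<Sum>l\<in>?D p. norm (?f (p, l))) =
          (\<Sum>l\<in>?D p. pochhammer (of_real a) (coord_sum l) * divided_monomial (norm_vec z) l)"
        using a by (simp only: prod.case norm_mult of_real_sum of_real_mult norm_pochhammer_of_real
            divided_monomial_norm_vec)
      also have "\<dots> = complex_of_real (pochhammer a p * (?r ^ p / fact p))"
        by (simp only: fibre coord_sum_norm_vec) (simp add: pochhammer_of_real)
      finally show "pochhammer a p * (?r ^ p / fact p) = (\<Sum>l\<in>?D p. norm (?f (p, l)))"
        by (simp only: of_real_eq_iff)
    qed simp
  next
    have "0 \<le> ?r" by (simp add: sum_nonneg)
    then have "((\<lambda>p. pochhammer (of_real a) p * (complex_of_real ?r ^ p / fact p)) has_sum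
      (1 - of_real ?r) powr of_real (- a)) UNIV"
      using a z by (intro binomial_series_neg_has_sum) (auto simp: abs_of_nonneg simp del: of_real_sum)
    then have "(\<lambda>p. complex_of_real (pochhammer a p * (?r ^ p / fact p))) summable_on UNIV"
      by (auto simp: pochhammer_of_real summable_on_def)
    then show "(\<lambda>p. pochhammer a p * (?r ^ p / fact p)) summable_on UNIV"
      using summable_on_Re by (fastforce simp only: Re_complex_of_real)
  qed auto
  then have "?f summable_on Sigma UNIV ?D" by (rule abs_summable_summable)
  moreover have "((\<lambda>l. ?f (p, l)) has_sum (pochhammer (of_real a) p * (coord_sum z ^ p / fact p))) (?D p)" for p
    unfolding fibre[symmetric] prod.case by (rule has_sum_finiteI) auto
  ultimately have "(?f has_sum (1 - coord_sum z) powr of_real (- a)) (Sigma UNIV ?D)"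
    by (intro has_sum_SigmaI[OF _ outer])
  moreover have "((\<lambda>l. pochhammer (of_real a) (coord_sum l) * divided_monomial z l) has_sum
      (1 - coord_sum z) powr of_real (- a)) UNIV \<longleftrightarrow>
      (?f has_sum (1 - coord_sum z) powr of_real (- a)) (Sigma UNIV ?D)"
    by (rule has_sum_reindex_bij_witness[of _ snd "\<lambda>m. (coord_sum m, m)"]) auto
  ultimately show ?thesis by simp
qed

section \<open>Explicit form of the Laguerre polynomials\<close>

text \<open>
  The contribution to the coefficient of \<open>z\<^sup>m\<^sup>+\<^sup>l\<close> in the generating function with parameter \<open>a - 1\<close>
  that comes from the term of multi-index \<open>m\<close> in the exponential series and the term of multi-index
  \<open>l\<close> in the expansion of \<open>(1 - \<langle>z\<rangle>)\<close> to the power \<open>- a - |m|\<close>.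
\<close>

definition laguerre_term :: "real \<Rightarrow> complex ^ 'k \<Rightarrow> nat ^ 'k \<Rightarrow> nat ^ 'k \<Rightarrow> complex" where
  "laguerre_term a x m l =
     divided_monomial (- x) m * pochhammer (of_real (a + coord_sum m)) (coord_sum l) * divided_monomial 1 l"

lemma monomial_add: "monomial z (m + l) = monomial z m * monomial z l"
  by (simp add: monomial_def power_add prod.distrib)

lemma divided_monomial_times_monomial:
  "divided_monomial w m * monomial z m = divided_monomial (hadamard w z) m"
  by (simp add: divided_monomial_def monomial_def hadamard_def power_mult_distrib flip: prod.distrib)

lemma laguerre_term_times_monomial:
  "laguerre_term a x m l * monomial z (m + l) =
     divided_monomial (hadamard (- x) z) m *
       (pochhammer (of_real (a + coord_sum m)) (coord_sum l) * divided_monomial z l)"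
proof -
  have "divided_monomial 1 l * monomial z l = divided_monomial z l"
    by (simp add: divided_monomial_times_monomial) (simp add: hadamard_def)
  moreover have "laguerre_term a x m l * monomial z (m + l) =
      (divided_monomial (- x) m * monomial z m) *
       (pochhammer (of_real (a + coord_sum m)) (coord_sum l) * (divided_monomial 1 l * monomial z l))"
    by (simp add: laguerre_term_def monomial_add)
  ultimately show ?thesis by (simp only: divided_monomial_times_monomial)
qed

text \<open>
  Summing over \<open>l\<close> first gives a negative power of \<open>1 - \<langle>z\<rangle>\<close>. What remains is the exponential
  series in the variables \<open>- x\<^sub>j z\<^sub>j / (1 - \<langle>z\<rangle>)\<close>. For unconditional convergence, the norms of the
  terms are the terms belonging to \<open>- norm_vec x\<close> and \<open>norm_vec z\<close>, where the sign offsets the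
  minus sign in the exponential; positivity of \<open>\<alpha> + 1\<close> makes the Pochhammer factors positive.
\<close>

lemma laguerre_double_series:
  fixes x z :: "complex ^ 'k"
  assumes z: "(\<Sum>j\<in>UNIV. norm (z $ j)) < 1" and a: "\<alpha> + 1 > 0"
  shows "((\<lambda>(m, l). laguerre_term (\<alpha> + 1) x m l * monomial z (m + l)) has_sum laguerre_gen \<alpha> x z)
    (UNIV \<times> UNIV)"
proof -
  let ?a = "\<alpha> + 1"
  let ?h = "\<lambda>x z (m, l). laguerre_term ?a x m l * monomial z (m + l)"
  let ?g = "\<lambda>x z m. divided_monomial (hadamard (- x) z) m * (1 - coord_sum z) powr of_real (- (?a + coord_sum m))"
  have inner: "((\<lambda>l. ?h x z (m, l)) has_sum ?g x z m) UNIV"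
    if "(\<Sum>j\<in>UNIV. norm (z $ j)) < 1" for m and x z :: "complex ^ 'k"
    unfolding prod.case laguerre_term_times_monomial
    using that a by (intro has_sum_cmult_right multivariate_binomial_series_neg) auto
  have outer: "(?g x z has_sum laguerre_gen \<alpha> x z) UNIV"
    if "(\<Sum>j\<in>UNIV. norm (z $ j)) < 1" for x z :: "complex ^ 'k"
  proof -
    have "norm (coord_sum z) < 1"
      using that norm_sum[of "\<lambda>j. z $ j" UNIV] by (simp add: coord_sum_def)
    then have nz: "1 - coord_sum z \<noteq> 0" by auto
    let ?w = "inverse (1 - coord_sum z) *s hadamard (- x) z"
    have "((\<lambda>m. (1 - coord_sum z) powr of_real (- ?a) * divided_monomial ?w m) has_sum
       ((1 - coord_sum z) powr of_real (- ?a) * exp (coord_sum ?w))) UNIV"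
      by (intro has_sum_cmult_right divided_monomial_has_sum_exp)
    moreover have "coord_sum ?w = - (coord_sum (hadamard x z) / (1 - coord_sum z))"
      by (simp add: coord_sum_def hadamard_def sum_negf divide_inverse flip: sum_distrib_left)
    moreover have "(1 - coord_sum z) powr of_real (- ?a) * divided_monomial ?w m = ?g x z m" for m
    proof -
      have "complex_of_real (- (?a + coord_sum m)) = of_real (- ?a) - of_nat (coord_sum m)"
        by simp
      then have "(1 - coord_sum z) powr of_real (- (?a + coord_sum m)) =
          (1 - coord_sum z) powr of_real (- ?a) * inverse (1 - coord_sum z) ^ coord_sum m"
        using nz by (simp only: powr_diff powr_nat if_False power_inverse divide_inverse divide_inverse)
      then show ?thesis
        by (simp only: divided_monomial_scale mult_ac)
    qed
    ultimately show ?thesis by (simp add: laguerre_gen_def)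
  qed
  have "(\<lambda>y. norm (?h x z y)) summable_on Sigma UNIV (\<lambda>_. UNIV)"
  proof (rule summable_on_SigmaI)
    let ?x = "- norm_vec x" and ?z = "norm_vec z"
    have z': "(\<Sum>j\<in>UNIV. norm (?z $ j)) < 1" using z by (simp add: norm_vec_def)
    have h: "?h ?x ?z (m, l) = of_real (norm (?h x z (m, l)))" for m l
    proof -
      have "hadamard (- ?x) ?z = norm_vec (hadamard (- x) z)"
        by (simp add: hadamard_def norm_vec_def vec_eq_iff norm_mult)
      moreover have "?a + coord_sum m > 0" using a by simp
      ultimately show ?thesis
        unfolding prod.case laguerre_term_times_monomial
        by (simp only: divided_monomial_norm_vec norm_mult of_real_mult norm_pochhammer_of_real)
    qed
    show "((\<lambda>l. norm (?h x z (m, l))) has_sum Re (?g ?x ?z m)) UNIV" for m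
      using has_sum_Re[OF inner[OF z', of ?x m]] by (simp only: h Re_complex_of_real)
    show "(\<lambda>m. Re (?g ?x ?z m)) summable_on UNIV"
      using outer[OF z', of ?x] by (intro summable_on_Re) (auto simp: summable_on_def)
  qed auto
  then have "?h x z summable_on Sigma UNIV (\<lambda>_. UNIV)" by (rule abs_summable_summable)
  then show ?thesis
    by (intro has_sum_SigmaI[where g = "?g x z"] inner outer z)
qed

definition laguerre_explicit :: "real \<Rightarrow> nat ^ 'k \<Rightarrow> complex ^ 'k \<Rightarrow> complex" where
  "laguerre_explicit \<alpha> n x = (\<Sum>m | \<forall>j. m $ j \<le> n $ j. laguerre_term (\<alpha> + 1) x m (n - m))"

lemma laguerre_explicit_gen:
  fixes x z :: "complex ^ 'k"
  assumes z: "(\<Sum>j\<in>UNIV. norm (z $ j)) < 1" and a: "\<alpha> > -1"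
  shows "((\<lambda>n. laguerre_explicit \<alpha> n x * monomial z n) has_sum laguerre_gen \<alpha> x z) UNIV"
proof -
  let ?D = "\<lambda>n. {m :: nat ^ 'k. \<forall>j. m $ j \<le> n $ j}"
  let ?h = "\<lambda>(n, m). laguerre_term (\<alpha> + 1) x m (n - m) * monomial z n"
  have "((\<lambda>(m, l). laguerre_term (\<alpha> + 1) x m l * monomial z (m + l)) has_sum laguerre_gen \<alpha> x z)
      (UNIV \<times> UNIV) \<longleftrightarrow> (?h has_sum laguerre_gen \<alpha> x z) (Sigma UNIV ?D)"
    by (rule has_sum_reindex_bij_witness[of _ "\<lambda>(n, m). (m, n - m)" "\<lambda>(m, l). (m + l, m)"])
      (auto simp: vec_eq_iff)
  then have "(?h has_sum laguerre_gen \<alpha> x z) (Sigma UNIV ?D)"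
    using laguerre_double_series[OF z, of \<alpha> x] a by simp
  then show ?thesis
    by (rule has_sum_SigmaD)
      (auto intro!: has_sum_finiteI simp: laguerre_explicit_def sum_distrib_right)
qed

lemma laguerre_eq_explicit:
  assumes "\<alpha> > -1"
  shows "laguerre \<alpha> n x = laguerre_explicit \<alpha> n x"
proof -
  have "(THE c. \<forall>z. (\<Sum>j\<in>UNIV. norm (z $ j)) < 1 \<longrightarrow>
      ((\<lambda>m. c m * monomial z m) has_sum laguerre_gen \<alpha> x z) UNIV) = (\<lambda>n. laguerre_explicit \<alpha> n x)"
  proof (rule the_equality)
    show "\<forall>z. (\<Sum>j\<in>UNIV. norm (z $ j)) < 1 \<longrightarrow>
      ((\<lambda>n. laguerre_explicit \<alpha> n x * monomial z n) has_sum laguerre_gen \<alpha> x z) UNIV"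
      by (intro allI impI laguerre_explicit_gen[OF _ assms])
    then show "c = (\<lambda>n. laguerre_explicit \<alpha> n x)"
      if "\<forall>z. (\<Sum>j\<in>UNIV. norm (z $ j)) < 1 \<longrightarrow>
        ((\<lambda>m. c m * monomial z m) has_sum laguerre_gen \<alpha> x z) UNIV" for c
      using that by (intro power_series_coeffs_unique[where F = "laguerre_gen \<alpha> x"]) auto
  qed
  then show ?thesis by (simp add: laguerre_def)
qed

definition laguerre1_coeff :: "real \<Rightarrow> nat \<Rightarrow> nat \<Rightarrow> complex" where
  "laguerre1_coeff \<alpha> n i = (-1) ^ i / fact i * pochhammer (of_real (\<alpha> + 1 + i)) (n - i) / fact (n - i)"

text \<open>
  The index type of \<open>nat ^ 1\<close> has a single element, so multi-indices are natural numbers via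
  \<open>vec\<close>.
\<close>

lemma laguerre1_polynomial:
  assumes "\<alpha> > -1"
  shows "laguerre1 \<alpha> n x = (\<Sum>i\<le>n. laguerre1_coeff \<alpha> n i * x ^ i)"
proof -
  have "laguerre1 \<alpha> n x = (\<Sum>m | \<forall>j. m $ j \<le> n. laguerre_term (\<alpha> + 1) (vec x) m (vec n - m :: nat ^ 1))"
    unfolding laguerre1_def laguerre_eq_explicit[OF assms] laguerre_explicit_def by simp
  also have "\<dots> = (\<Sum>i\<le>n. laguerre1_coeff \<alpha> n i * x ^ i)"
    by (rule sum.reindex_bij_witness[of _ vec "\<lambda>m. m $ 1"])
      (auto simp: vec_eq_iff forall_1 laguerre_term_def divided_monomial_def coord_sum_def
        laguerre1_coeff_def power_minus[of x] add_ac)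
  finally show ?thesis .
qed

section \<open>The Dirichlet integral\<close>

lemma borel_measurable_coord_sum [measurable]:
  "(coord_sum :: real ^ 'k \<Rightarrow> real) \<in> borel_measurable borel"
  unfolding coord_sum_def[abs_def] by measurable

text \<open>
  This transports \<open>nn_integral_lborel_prod\<close> from products over the standard basis to products over
  coordinates.
\<close>

lemma nn_integral_lborel_prod_vec:
  fixes f :: "'k::finite \<Rightarrow> real \<Rightarrow> ennreal"
  assumes "\<And>j. f j \<in> borel_measurable borel"
  shows "(\<integral>\<^sup>+ s. (\<Prod>j\<in>UNIV. f j (s $ j)) \<partial>(lborel :: (real ^ 'k) measure)) =
    (\<Prod>j\<in>UNIV. \<integral>\<^sup>+ t. f j t \<partial>lborel)"
proof -
  let ?ax = "\<lambda>j::'k. axis j (1::real)"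
  define ix where "ix = inv_into UNIV ?ax"
  have inj: "inj ?ax" by (auto simp: inj_on_def axis_eq_axis)
  have Basis: "(Basis :: (real ^ 'k) set) = range ?ax" by (auto simp: Basis_vec_def)
  have ix [simp]: "ix (?ax j) = j" for j
    unfolding ix_def by (rule inv_f_f[OF inj])
  have "(\<integral>\<^sup>+ s. (\<Prod>b\<in>Basis. f (ix b) (s \<bullet> b)) \<partial>(lborel :: (real ^ 'k) measure)) =
      (\<Prod>b\<in>(Basis :: (real ^ 'k) set). \<integral>\<^sup>+ t. f (ix b) t \<partial>lborel)"
    using assms by (intro nn_integral_lborel_prod) auto
  then show ?thesis
    using inj by (simp add: Basis prod.reindex inner_axis)
qed

lemma nn_integral_lborel_scale:
  fixes f :: "real ^ 'k \<Rightarrow> ennreal"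
  assumes [measurable]: "f \<in> borel_measurable borel" and "t > 0"
  shows "(\<integral>\<^sup>+ s. f s \<partial>lborel) = ennreal (t ^ CARD('k)) * (\<integral>\<^sup>+ s. f (t *\<^sub>R s) \<partial>lborel)"
  using \<open>t > 0\<close>
  by (subst lborel_affine[of t 0])
    (simp_all add: nn_integral_density nn_integral_distr nn_integral_cmult)

text \<open>
  The unnormalised density of the Gamma distribution without its exponential factor. The cutoff at
  \<open>0\<close> is built in, because the real power of a negative base need not vanish; a product of such
  functions then carries the indicator of the simplex with it.
\<close>

definition gamma_density :: "real \<Rightarrow> real \<Rightarrow> real" where
  "gamma_density a t = indicator {0..} t * t powr (a - 1)"

lemma gamma_density_nonneg [simp]: "gamma_density a t \<ge> 0"
  by (simp add: gamma_density_def)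

lemma borel_measurable_gamma_density [measurable]: "gamma_density a \<in> borel_measurable borel"
  unfolding gamma_density_def[abs_def] by measurable

lemma gamma_density_scale:
  "t > 0 \<Longrightarrow> gamma_density a (t * u) = t powr (a - 1) * gamma_density a u"
  by (auto simp: gamma_density_def indicator_def powr_mult zero_le_mult_iff)

lemma nn_integral_gamma_density:
  "a > 0 \<Longrightarrow> (\<integral>\<^sup>+ t. ennreal (gamma_density a t / exp t) \<partial>lborel) = ennreal (Gamma a)"
  by (simp add: Gamma_conv_nn_integral_real gamma_density_def)

text \<open>
  Let \<open>J(t)\<close> be the same integral over the simplex \<open>\<langle>s\<rangle> \<le> t\<close> with \<open>t - \<langle>s\<rangle>\<close> in place of
  \<open>1 - \<langle>s\<rangle>\<close>, and integrate \<open>J(t) exp (-t)\<close> over \<open>t\<close> in two ways. Scaling gives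
  \<open>J(t) = t\<^sup>c\<^sup>-\<^sup>1 J(1)\<close> with \<open>c = \<Sum>a\<^sub>j + b\<close>, hence the value \<open>\<Gamma>(c) J(1)\<close>. Integrating over \<open>t\<close> first,
  after the shift \<open>t = u + \<langle>s\<rangle>\<close>, separates all variables and gives \<open>\<Gamma>(b) \<Prod>\<Gamma>(a\<^sub>j)\<close>.
\<close>

lemma dirichlet_nn_integral:
  fixes a :: "'k::finite \<Rightarrow> real"
  assumes a: "\<And>j. a j > 0" and b: "b > 0"
  shows "(\<integral>\<^sup>+ s. ennreal ((\<Prod>j\<in>UNIV. gamma_density (a j) (s $ j)) * gamma_density b (1 - coord_sum s))
      \<partial>(lborel :: (real ^ 'k) measure)) =
    ennreal ((\<Prod>j\<in>UNIV. Gamma (a j)) * Gamma b / Gamma ((\<Sum>j\<in>UNIV. a j) + b))"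
    (is "?I = _")
proof -
  define f where "f = (\<lambda>s :: real ^ 'k. \<Prod>j\<in>UNIV. gamma_density (a j) (s $ j))"
  have [measurable]: "f \<in> borel_measurable borel" unfolding f_def by measurable
  have f_nonneg [simp]: "f s \<ge> 0" for s by (simp add: f_def prod_nonneg)
  have f_support: "coord_sum s \<ge> 0" if "f s \<noteq> 0" for s
    using that by (auto simp: f_def gamma_density_def coord_sum_def indicator_def intro!: sum_nonneg split: if_splits)
  let ?g = "\<lambda>t s. ennreal (f s * gamma_density b (t - coord_sum s) / exp t)"
  let ?c = "(\<Sum>j\<in>UNIV. a j) + b"
  have c: "?c > 0" using a b by (simp add: add_nonneg_pos sum_nonneg less_imp_le)
  have "(\<integral>\<^sup>+ s. \<integral>\<^sup>+ t. ?g t s \<partial>lborel \<partial>lborel) = (\<integral>\<^sup>+ t. \<integral>\<^sup>+ s. ?g t s \<partial>lborel \<partial>lborel)"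
    by (rule lborel_pair.Fubini') measurable
  moreover have "(\<integral>\<^sup>+ t. ?g t s \<partial>lborel) = ennreal (Gamma b) * (\<Prod>j\<in>UNIV. ennreal (gamma_density (a j) (s $ j) / exp (s $ j)))" for s
  proof -
    have "(\<integral>\<^sup>+ t. ?g t s \<partial>lborel) = (\<integral>\<^sup>+ u. ?g (coord_sum s + 1 * u) s \<partial>lborel)"
      by (subst nn_integral_real_affine[where c = 1 and t = "coord_sum s"]) auto
    also have "\<dots> = (\<integral>\<^sup>+ u. ennreal (f s / exp (coord_sum s)) * ennreal (gamma_density b u / exp u) \<partial>lborel)"
      by (intro nn_integral_cong) (simp add: exp_add flip: ennreal_mult)
    also have "\<dots> = ennreal (f s / exp (coord_sum s)) * ennreal (Gamma b)"
      using b by (subst nn_integral_cmult) (auto simp: nn_integral_gamma_density)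
    also have "f s / exp (coord_sum s) = (\<Prod>j\<in>UNIV. gamma_density (a j) (s $ j) / exp (s $ j))"
      by (simp add: f_def coord_sum_def exp_sum prod_dividef)
    finally show ?thesis by (simp add: prod_ennreal mult.commute)
  qed
  moreover have "(\<integral>\<^sup>+ s. ennreal (Gamma b) * (\<Prod>j\<in>UNIV. ennreal (gamma_density (a j) (s $ j) / exp (s $ j)))
      \<partial>(lborel :: (real ^ 'k) measure)) = ennreal ((\<Prod>j\<in>UNIV. Gamma (a j)) * Gamma b)"
  proof -
    have "(\<integral>\<^sup>+ s. (\<Prod>j\<in>UNIV. ennreal (gamma_density (a j) (s $ j) / exp (s $ j)))
      \<partial>(lborel :: (real ^ 'k) measure)) = (\<Prod>j\<in>UNIV. ennreal (Gamma (a j)))"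
      using a by (subst nn_integral_lborel_prod_vec) (auto simp: nn_integral_gamma_density)
    then show ?thesis
      using a b by (subst nn_integral_cmult)
        (auto simp: prod_ennreal ennreal_mult prod_nonneg mult.commute Gamma_real_nonneg less_imp_le)
  qed
  moreover have "(\<integral>\<^sup>+ s. ?g t s \<partial>lborel) = ?I * ennreal (gamma_density ?c t / exp t)" if "t \<noteq> 0" for t
  proof (cases "t > 0")
    case True
    have "?g t (t *\<^sub>R s) = ennreal (t powr (\<Sum>j\<in>UNIV. a j - 1) * t powr (b - 1) / exp t) *
        ennreal (f s * gamma_density b (1 - coord_sum s))" for s
    proof -
      have "f (t *\<^sub>R s) = t powr (\<Sum>j\<in>UNIV. a j - 1) * f s"
        using True by (simp add: f_def gamma_density_scale prod.distrib powr_sum)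
      moreover have "t - coord_sum (t *\<^sub>R s) = t * (1 - coord_sum s)"
        by (simp add: coord_sum_def algebra_simps sum_distrib_left)
      ultimately show ?thesis
        using True by (simp add: gamma_density_scale mult_ac flip: ennreal_mult)
    qed
    then have "(\<integral>\<^sup>+ s. ?g t s \<partial>lborel) =
        ennreal (t ^ CARD('k)) * (ennreal (t powr (\<Sum>j\<in>UNIV. a j - 1) * t powr (b - 1) / exp t) * ?I)"
      using True by (subst nn_integral_lborel_scale[where t = t]) (auto simp: nn_integral_cmult f_def)
    also have "\<dots> = ?I * ennreal (t ^ CARD('k) * (t powr (\<Sum>j\<in>UNIV. a j - 1) * t powr (b - 1) / exp t))"
      using True by (subst ennreal_mult) (auto simp: mult_ac)
    also have "t ^ CARD('k) * (t powr (\<Sum>j\<in>UNIV. a j - 1) * t powr (b - 1) / exp t) =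
        gamma_density ?c t / exp t"
      using True by (simp add: gamma_density_def sum_subtractf powr_diff powr_add powr_realpow field_simps)
    finally show ?thesis .
  next
    case False
    have "f s * gamma_density b (t - coord_sum s) / exp t = 0" for s
      using f_support[of s] False that by (auto simp: gamma_density_def)
    then have "(\<integral>\<^sup>+ s. ?g t s \<partial>lborel) = (\<integral>\<^sup>+ s. 0 \<partial>(lborel :: (real ^ 'k) measure))"
      by (simp only: ennreal_0)
    moreover have "gamma_density ?c t = 0" using False that by (simp add: gamma_density_def)
    ultimately show ?thesis by simp
  qed
  then have "(\<integral>\<^sup>+ t. \<integral>\<^sup>+ s. ?g t s \<partial>lborel \<partial>lborel) = (\<integral>\<^sup>+ t. ?I * ennreal (gamma_density ?c t / exp t) \<partial>lborel)"
    using AE_lborel_singleton[of "0::real"] by (intro nn_integral_cong_AE) auto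
  moreover have "\<dots> = ?I * ennreal (Gamma ?c)"
    using c by (subst nn_integral_cmult) (auto simp: nn_integral_gamma_density)
  ultimately have eq: "?I * ennreal (Gamma ?c) = ennreal ((\<Prod>j\<in>UNIV. Gamma (a j)) * Gamma b)"
    by simp
  have pos: "Gamma ?c > 0" using c by (rule Gamma_real_pos)
  have "?I = ?I * ennreal (Gamma ?c) / ennreal (Gamma ?c)"
    using pos by (simp add: ennreal_mult_divide_eq)
  also have "\<dots> = ennreal ((\<Prod>j\<in>UNIV. Gamma (a j)) * Gamma b / Gamma ?c)"
    unfolding eq using pos a b
    by (intro divide_ennreal) (auto intro!: mult_pos_pos prod_pos Gamma_real_pos less_imp_le)
  finally show ?thesis .
qed

text \<open>
  The conditions \<open>s\<^sub>j \<ge> 0\<close> and \<open>1 - \<langle>s\<rangle> \<ge> 0\<close> that cut out the simplex are the cutoffs of the Gamma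
  densities.
\<close>

lemma indicator_std_simplex:
  "indicator std_simplex s * ((\<Prod>j\<in>UNIV. s $ j powr (a j - 1)) * (1 - coord_sum s) powr (b - 1)) =
     (\<Prod>j\<in>UNIV. gamma_density (a j) (s $ j)) * gamma_density b (1 - coord_sum s)"
proof (cases "\<forall>j. s $ j \<ge> 0")
  case True
  then show ?thesis by (auto simp: std_simplex_def gamma_density_def indicator_def)
next
  case False
  then obtain i where "s $ i < 0" by (auto simp: not_le)
  then have "gamma_density (a i) (s $ i) = 0" "s \<notin> std_simplex"
    by (auto simp: gamma_density_def std_simplex_def not_le)
  then show ?thesis by (auto simp: prod_zero_iff)
qed

lemma has_bochner_integral_dirichlet:
  fixes a :: "'k::finite \<Rightarrow> real"
  assumes "\<And>j. a j > 0" "b > 0"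
  shows "has_bochner_integral (lborel :: (real ^ 'k) measure)
    (\<lambda>s. (\<Prod>j\<in>UNIV. gamma_density (a j) (s $ j)) * gamma_density b (1 - coord_sum s))
    ((\<Prod>j\<in>UNIV. Gamma (a j)) * Gamma b / Gamma ((\<Sum>j\<in>UNIV. a j) + b))"
proof (rule has_bochner_integral_nn_integral)
  show "0 \<le> (\<Prod>j\<in>UNIV. Gamma (a j)) * Gamma b / Gamma ((\<Sum>j\<in>UNIV. a j) + b)"
    using assms by (intro divide_nonneg_nonneg mult_nonneg_nonneg prod_nonneg Gamma_real_nonneg
        add_nonneg_pos sum_nonneg ballI) (auto intro: less_imp_le)
qed (use assms dirichlet_nn_integral in \<open>auto simp: prod_nonneg\<close>)

section \<open>The integral representation\<close>

lemma prod_sum_multi_index: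
  fixes g :: "'k::finite \<Rightarrow> nat \<Rightarrow> 'a::comm_semiring_1"
  shows "(\<Prod>j\<in>UNIV. \<Sum>i\<le>n $ j. g j i) = (\<Sum>m | \<forall>j. m $ j \<le> n $ j. \<Prod>j\<in>UNIV. g j (m $ j))"
proof -
  have "(\<Prod>j\<in>UNIV. \<Sum>i\<le>n $ j. g j i) = (\<Sum>h\<in>PiE UNIV (\<lambda>j. {..n $ j}). \<Prod>j\<in>UNIV. g j (h j))"
    by (rule prod_sum_PiE) auto
  also have "\<dots> = (\<Sum>m | \<forall>j. m $ j \<le> n $ j. \<Prod>j\<in>UNIV. g j (m $ j))"
    by (rule sum.reindex_bij_witness[of _ "\<lambda>m j. m $ j" "\<lambda>h. \<chi> j. h j"]) auto
  finally show ?thesis .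
qed

theorem proposition5p1:
  fixes n :: "nat ^ 'k" and lam :: "real ^ 'k" and \<alpha> :: real and x :: "complex ^ 'k"
  assumes "\<And>j. lam $ j > -1" and "\<alpha> > -1"
  shows "laguerre (coord_sum lam + \<alpha> + real CARD('k)) n x =
    complex_of_real
      (Gamma (coord_sum (\<chi> j. lam $ j + real (n $ j)) + \<alpha> + real CARD('k) + 1) /
       (\<Prod>j\<in>UNIV. Gamma (lam $ j + 1 + real (n $ j)))) *
    oshima_K (\<alpha> + 1) (\<chi> j. lam $ j + 1)
      (\<lambda>y. \<Prod>j\<in>UNIV. laguerre1 (lam $ j) (n $ j) (y $ j)) x"
proof -
  let ?D = "{m :: nat ^ 'k. \<forall>j. m $ j \<le> n $ j}"
  define A where "A = coord_sum lam + \<alpha> + real CARD('k)"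
  define c where "c = (\<lambda>m. \<Prod>j\<in>UNIV. laguerre1_coeff (lam $ j) (n $ j) (m $ j) * (x $ j) ^ (m $ j))"
  define d where "d = (\<lambda>m::nat^'k. \<lambda>s. (\<Prod>j\<in>UNIV. gamma_density (lam $ j + 1 + m $ j) (s $ j)) *
    gamma_density (\<alpha> + 1) (1 - coord_sum s))"
  define I where "I = (\<lambda>m::nat^'k. (\<Prod>j\<in>UNIV. Gamma (lam $ j + 1 + m $ j)) * Gamma (\<alpha> + 1) / Gamma (A + 1 + coord_sum m))"
  let ?w = "\<lambda>s. (\<Prod>j\<in>UNIV. s $ j powr ((\<chi> j. lam $ j + 1) $ j - 1)) * (1 - coord_sum s) powr (\<alpha> + 1 - 1)"
  let ?P = "\<lambda>y :: complex ^ 'k. \<Prod>j\<in>UNIV. laguerre1 (lam $ j) (n $ j) (y $ j)"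
  have A: "A > -1"
  proof -
    have "(\<Sum>j\<in>(UNIV::'k set). -1) < (\<Sum>j\<in>UNIV. lam $ j)"
      using assms(1) by (intro sum_strict_mono) auto
    then show ?thesis using assms(2) by (simp add: A_def coord_sum_def)
  qed
  have d_integral: "has_bochner_integral lborel (d m) (I m)" for m
  proof -
    have "(\<Sum>j\<in>UNIV. lam $ j + 1 + m $ j) + (\<alpha> + 1) = A + 1 + coord_sum m"
      by (simp add: A_def coord_sum_def sum.distrib)
    moreover have "lam $ j + 1 + m $ j > 0" for j using assms(1)[of j] by simp
    ultimately show ?thesis
      using has_bochner_integral_dirichlet[of "\<lambda>j. lam $ j + 1 + m $ j" "\<alpha> + 1"] assms(2)
      by (simp only: d_def I_def)
  qed
  \<comment> \<open>The integrand of the operator is a finite combination of Dirichlet densities.\<close>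
  have expand: "indicator std_simplex s *\<^sub>R (of_real (?w s) * ?P (hadamard x (\<chi> j. of_real (s $ j)))) =
      (\<Sum>m\<in>?D. c m * of_real (d m s))" for s
  proof -
    have "?P (hadamard x (\<chi> j. of_real (s $ j))) =
        (\<Prod>j\<in>UNIV. \<Sum>i\<le>n $ j. laguerre1_coeff (lam $ j) (n $ j) i * (x $ j * of_real (s $ j)) ^ i)"
      using assms(1) by (simp add: laguerre1_polynomial hadamard_def)
    also have "\<dots> = (\<Sum>m\<in>?D. c m * of_real (\<Prod>j\<in>UNIV. s $ j ^ (m $ j)))"
      by (simp add: prod_sum_multi_index c_def power_mult_distrib mult_ac flip: prod.distrib)
    finally have P: "?P (hadamard x (\<chi> j. of_real (s $ j))) = \<dots>" .
    have weight: "indicator std_simplex s * ?w s * (\<Prod>j\<in>UNIV. s $ j ^ (m $ j)) = d m s" for m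
    proof -
      have "gamma_density (lam $ j + 1) (s $ j) * s $ j ^ (m $ j) = gamma_density (lam $ j + 1 + m $ j) (s $ j)" for j
        \<comment> \<open>For \<open>s $ j \<le> 0\<close> both sides vanish, at \<open>0\<close> because \<open>0 powr r = 0\<close> for every \<open>r\<close>.\<close>
        by (cases "s $ j > 0") (auto simp: gamma_density_def indicator_def powr_add powr_realpow)
      then show ?thesis
        using indicator_std_simplex[of s "\<lambda>j. lam $ j + 1" "\<alpha> + 1"]
        by (simp add: d_def mult_ac flip: prod.distrib)
    qed
    show ?thesis
      unfolding P sum_distrib_left scaleR_sum_right weight[symmetric]
      by (simp only: scaleR_conv_of_real of_real_mult mult_ac)
  qed
  have "oshima_K (\<alpha> + 1) (\<chi> j. lam $ j + 1) ?P x = of_real (1 / Gamma (\<alpha> + 1)) *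
      (LINT s|lborel. (\<Sum>m\<in>?D. c m * of_real (d m s)))"
    unfolding oshima_K_def set_lebesgue_integral_def expand ..
  also have "(LINT s|lborel. (\<Sum>m\<in>?D. c m * of_real (d m s))) = (\<Sum>m\<in>?D. c m * of_real (I m))"
    using d_integral
    by (intro has_bochner_integral_integral_eq has_bochner_integral_sum has_bochner_integral_mult_right
        has_bochner_integral_of_real)
  finally have K: "oshima_K (\<alpha> + 1) (\<chi> j. lam $ j + 1) ?P x =
     of_real (1 / Gamma (\<alpha> + 1)) * (\<Sum>m\<in>?D. c m * of_real (I m))" .
  let ?G = "\<Prod>j\<in>UNIV. Gamma (lam $ j + 1 + n $ j)"
  have pochhammer_eq: "pochhammer (of_real u) p = (of_real (Gamma (u + p) / Gamma u) :: complex)"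
    if "u > 0" for u :: real and p
    using that pochhammer_Gamma[of u p] by (simp add: pochhammer_of_real nonpos_Ints_def)
  have laguerre_term_eq: "laguerre_term (A + 1) x m (n - m) =
     of_real (Gamma (A + 1 + coord_sum n) / ?G) * (of_real (1 / Gamma (\<alpha> + 1)) * (c m * of_real (I m)))"
    if m: "m \<in> ?D" for m
  proof -
    \<comment> \<open>The Gamma factors of the Dirichlet integral clear the one-variable Pochhammer symbols.\<close>
    have coeff: "c m * of_real (\<Prod>j\<in>UNIV. Gamma (lam $ j + 1 + m $ j)) =
        divided_monomial (- x) m * divided_monomial 1 (n - m) * of_real ?G"
    proof -
      have "laguerre1_coeff (lam $ j) (n $ j) (m $ j) * x $ j ^ (m $ j) * of_real (Gamma (lam $ j + 1 + m $ j)) =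
         (- x $ j) ^ (m $ j) / fact (m $ j) * (1 / fact (n $ j - m $ j)) * of_real (Gamma (lam $ j + 1 + n $ j))" for j
      proof -
        have pos: "lam $ j + 1 + m $ j > 0" using assms(1)[of j] by simp
        then have nonzero: "Gamma (lam $ j + 1 + m $ j) \<noteq> 0" using Gamma_real_pos[OF pos] by linarith
        have deg: "lam $ j + 1 + m $ j + real (n $ j - m $ j) = lam $ j + 1 + n $ j" using m by simp
        have "pochhammer (of_real (lam $ j + 1 + m $ j)) (n $ j - m $ j) *
            of_real (Gamma (lam $ j + 1 + m $ j)) = complex_of_real (Gamma (lam $ j + 1 + n $ j))"
          unfolding pochhammer_eq[OF pos] deg using nonzero by simp
        then show ?thesis
          unfolding laguerre1_coeff_def power_minus[of "x $ j"] divide_inverse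
          by (simp only: mult_ac mult_1_left mult_1_right)
      qed
      then show ?thesis
        by (simp add: c_def divided_monomial_def flip: prod.distrib)
    qed
    have "coord_sum m + coord_sum (n - m) = coord_sum n"
      using m by (simp add: coord_sum_def flip: sum.distrib)
    then have deg: "A + 1 + coord_sum m + coord_sum (n - m) = A + 1 + coord_sum n"
      by linarith
    have pos: "A + 1 + coord_sum m > 0" using A by simp
    have "lam $ j + 1 + n $ j > 0" for j using assms(1)[of j] by simp
    then have "?G > 0" by (intro prod_pos Gamma_real_pos)
    moreover have "Gamma (\<alpha> + 1) > 0" using assms(2) by (intro Gamma_real_pos) simp
    ultimately have nonzero: "?G \<noteq> 0" "Gamma (\<alpha> + 1) \<noteq> 0" by linarith+
    have "c m * of_real (I m) =
        (c m * of_real (\<Prod>j\<in>UNIV. Gamma (lam $ j + 1 + m $ j))) *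
          of_real (Gamma (\<alpha> + 1) / Gamma (A + 1 + coord_sum m))"
      unfolding I_def by simp
    also have "\<dots> = divided_monomial (- x) m * divided_monomial 1 (n - m) *
        of_real (?G * (Gamma (\<alpha> + 1) / Gamma (A + 1 + coord_sum m)))"
      unfolding coeff by (simp only: of_real_mult mult_ac)
    finally have "of_real (Gamma (A + 1 + coord_sum n) / ?G) * (of_real (1 / Gamma (\<alpha> + 1)) * (c m * of_real (I m))) =
        divided_monomial (- x) m * divided_monomial 1 (n - m) *
        of_real (Gamma (A + 1 + coord_sum n) / ?G * (1 / Gamma (\<alpha> + 1)) *
          (?G * (Gamma (\<alpha> + 1) / Gamma (A + 1 + coord_sum m))))"
      by (simp only: of_real_mult mult_ac)
    also have "Gamma (A + 1 + coord_sum n) / ?G * (1 / Gamma (\<alpha> + 1)) *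
          (?G * (Gamma (\<alpha> + 1) / Gamma (A + 1 + coord_sum m))) =
        Gamma (A + 1 + coord_sum n) / Gamma (A + 1 + coord_sum m)"
      using nonzero by (simp add: divide_simps)
    finally show ?thesis
      unfolding laguerre_term_def pochhammer_eq[OF pos] deg by (simp only: mult_ac)
  qed
  have "coord_sum (\<chi> j. lam $ j + real (n $ j)) + \<alpha> + real CARD('k) + 1 = A + 1 + coord_sum n"
    by (simp add: A_def coord_sum_def sum.distrib)
  moreover have "laguerre A n x = of_real (Gamma (A + 1 + coord_sum n) / ?G) *
      (of_real (1 / Gamma (\<alpha> + 1)) * (\<Sum>m\<in>?D. c m * of_real (I m)))"
    unfolding laguerre_eq_explicit[OF A] laguerre_explicit_def sum_distrib_left
    by (intro sum.cong refl laguerre_term_eq)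
  ultimately show ?thesis
    unfolding K A_def[symmetric] by (simp only:)
qed

end
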